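(* Let $\mathbb{K}$ be either $\mathbb{R}$ or $\mathbb{C}$. Let $\mathbf{A}\in\mathbb{K}^{m\times n}$, $\mathbf{F}\in\mathbb{K}^{m\times r}$ and $\mathbf{H}\in\mathbb{K}^{n\times q}$ be matrices of rank $k$, where $k\le\min\{m,n\}$, $k\le r$ and $k\le q$, such that $\mathcal{C}(\mathbf{A})\subseteq\mathcal{C}(\mathbf{F})$ and $\mathcal{C}(\mathbf{A}^* )\subseteq\mathcal{C}(\mathbf{H})$. Suppose that $\mathbf{B}\in\mathbb{K}^{m\times r}$ and $\mathbf{D}\in\mathbb{K}^{n\times q}$ satisfy $$\mathrm{rank}(\mathbf{B}^*\mathbf{F})=\mathrm{rank}(\mathbf{H}^*\mathbf{D})=k.$$ Let $$\mathbf{Y}^*=(\mathbf{B}^*\mathbf{F})^+\mathbf{B}^*\in\mathbb{K}^{r\times m}\quad\text{and}\quad \mathbf{X}=\mathbf{D}(\mathbf{H}^*\mathbf{D})^+\in\mathbb{K}^{n\times q}.$$ Then for every $\mathbf{W}\in\mathbb{K}^{r\times q}$, setting $$\mathbf{G}=\mathbf{Y}^*\mathbf{A}\mathbf{X}+\mathbf{W}-\mathbf{Y}^*\mathbf{F}\mathbf{W}\mathbf{H}^*\mathbf{X},$$ one has $$\mathbf{A}=\mathbf{F}\mathbf{G}\mathbf{H}^*.$$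
   Context: For a matrix $\mathbf{M}$ over $\mathbb{K}$, $\mathbf{M}^*$ denotes its conjugate transpose (the transpose if $\mathbb{K}=\mathbb{R}$), $\mathcal{C}(\mathbf{M})$ denotes its column space, and $\mathbf{M}^+$ denotes its Moore-Penrose pseudoinverse, i.e. the unique matrix satisfying $\mathbf{M}\mathbf{M}^+\mathbf{M}=\mathbf{M}$, $\mathbf{M}^+\mathbf{M}\mathbf{M}^+=\mathbf{M}^+$, $(\mathbf{M}\mathbf{M}^+)^*=\mathbf{M}\mathbf{M}^+$ and $(\mathbf{M}^+\mathbf{M})^*=\mathbf{M}^+\mathbf{M}$. *)

theory Defs
  imports
    "Jordan_Normal_Form.DL_Rank"
    "Jordan_Normal_Form.Schur_Decomposition"
begin

text \<open>
  Over \<^typ>\<open>real\<close> conjugation is the identity, so there \<^const>\<open>mat_adjoint\<close> is the transpose.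
\<close>

definition is_pseudoinverse :: "'a :: conjugatable_field mat \<Rightarrow> 'a mat \<Rightarrow> bool" where
  "is_pseudoinverse M P \<longleftrightarrow>
     P \<in> carrier_mat (dim_col M) (dim_row M) \<and>
     M * P * M = M \<and>
     P * M * P = P \<and>
     mat_adjoint (M * P) = M * P \<and>
     mat_adjoint (P * M) = P * M"

text \<open>
  The dimension condition is essential for the description below: multiplication of matrices of
  type \<^typ>\<open>'a mat\<close> is total, also when the dimensions do not fit. Existence of a
  pseudoinverse may fail over an arbitrary field with conjugation; it holds over the reals and
  the complex numbers.
\<close>

definition pseudoinverse :: "'a :: conjugatable_field mat \<Rightarrow> 'a mat" where
  "pseudoinverse M = (THE P. is_pseudoinverse M P)"

end

theory Submission
  imports Defs
begin

text \<open>
  Put $M_1 = B^*F$ and $M_2 = H^*D$. Since $M_1$ has the rank of $F$ and $M_2$ that of $H$,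
  nothing is lost in these products: $F = U M_1$ and $H^* = M_2 V$ for some $U$, $V$. With
  $M_i M_i^+ M_i = M_i$ this gives $F Y^* F = F$ and $H^* X H^* = H^*$. As $A = F Z = Z' H^*$ by the
  inclusions of column spaces, also $F Y^* A = A$ and $A X H^* = A$, so in $F G H^*$ the first term is
  $A$ and the two terms with $W$ cancel.
\<close>

section \<open>Matrix products and conjugate transposes\<close>

text \<open>The premises are dimension equations rather than carrier memberships, so the simplifier
  can settle them and reassociate long products to the right.\<close>

lemma mult_assoc_dim:
  fixes A B C :: "'a::semiring_0 mat"
  assumes "dim_col A = dim_row B" and "dim_col B = dim_row C"
  shows "A * B * C = A * (B * C)"
  using assms by (intro assoc_mult_mat) (auto intro: carrier_matI)

text \<open>Cancels a one-sided inverse in a product associated to the right, where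
  \<open>A * B\<close> does not occur as a subterm.\<close>

lemma mult_left_cancel_one:
  fixes A B C :: "'a::semiring_1 mat"
  assumes "A * B = 1\<^sub>m k" and "dim_col A = dim_row B" and "dim_col B = dim_row C" and "dim_row C = k"
  shows "A * (B * C) = C"
proof -
  have "A * (B * C) = A * B * C"
    using assms(2,3) by (rule mult_assoc_dim[symmetric])
  also have "\<dots> = C"
    unfolding assms(1) using assms(4) by (intro left_mult_one_mat) (auto intro: carrier_matI)
  finally show ?thesis .
qed

lemma dim_mat_adjoint [simp]:
  "dim_row (mat_adjoint A) = dim_col A" "dim_col (mat_adjoint A) = dim_row A"
  unfolding mat_adjoint_def by auto

lemma mat_adjoint_carrier [simp]:
  "A \<in> carrier_mat m n \<Longrightarrow> mat_adjoint A \<in> carrier_mat n m"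
  by (intro carrier_matI) auto

lemma index_mat_adjoint [simp]:
  "i < dim_col A \<Longrightarrow> j < dim_row A \<Longrightarrow> mat_adjoint A $$ (i, j) = conjugate (A $$ (j, i))"
  unfolding mat_adjoint_def by (auto simp: mat_of_rows_index)

lemma mat_adjoint_adjoint [simp]: "mat_adjoint (mat_adjoint A) = A"
  by (intro eq_matI) auto

lemma conjugate_one [simp]: "conjugate (1 :: 'a::conjugatable_field) = 1"
  \<comment> \<open>Both sides of multiplicativity at \<open>1 * conjugate 1\<close> collapse by
    involutivity: one to \<open>1\<close>, the other to \<open>conjugate 1\<close>.\<close>
  using conjugate_dist_mul[of "1::'a" "conjugate 1"] by simp

lemma mat_adjoint_one [simp]: "mat_adjoint (1\<^sub>m n) = 1\<^sub>m n"
  by (intro eq_matI) auto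

lemma mat_adjoint_mult:
  fixes A B :: "'a::conjugatable_field mat"
  assumes "dim_col A = dim_row B"
  shows "mat_adjoint (A * B) = mat_adjoint B * mat_adjoint A"
  using assms
  by (intro eq_matI)
    (auto simp: scalar_prod_def sum_conjugate conjugate_dist_mul mult.commute intro!: sum.cong)

section \<open>Column spaces and left factors\<close>

text \<open>Each column of \<open>A\<close> has a coefficient vector over the columns of
  \<open>F\<close>, and these vectors are the columns of \<open>Z\<close>. The premise speaks of
  columns only, the form in which \<open>rank_factorization\<close> obtains it.\<close>

lemma cols_in_col_space_imp_factor:
  fixes A F :: "'a::field mat"
  assumes A: "A \<in> carrier_mat m n" and F: "F \<in> carrier_mat m r"
    and sub: "set (cols A) \<subseteq> vec_space.col_space m F"
  obtains Z where "Z \<in> carrier_mat r n" "A = F * Z"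
proof -
  interpret vec_space "TYPE('a)" m .
  have "\<exists>x\<in>carrier_vec r. F *\<^sub>v x = col A j" if "j < n" for j
  proof -
    have "col A j \<in> col_space F"
      using sub that A by (auto simp: cols_def)
    then show ?thesis using col_space_eq[OF F] F by auto
  qed
  then obtain x where x: "\<And>j. j < n \<Longrightarrow> x j \<in> carrier_vec r \<and> F *\<^sub>v x j = col A j"
    by metis
  define Z where "Z = mat_of_cols r (map x [0..<n])"
  have Z: "Z \<in> carrier_mat r n" unfolding Z_def by auto
  moreover have "A = F * Z"
  proof (rule mat_col_eqI)
    fix j assume "j < dim_col (F * Z)"
    then have j: "j < n" using Z by auto
    have "col Z j = x j" unfolding Z_def using j x by (subst col_mat_of_cols) auto
    then show "col A j = col (F * Z) j"
      using j x col_mult2[OF F Z j] by simp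
  qed (use A F Z in auto)
  ultimately show thesis by (rule that)
qed

lemma col_space_subset_imp_factor:
  fixes A F :: "'a::field mat"
  assumes A: "A \<in> carrier_mat m n" and F: "F \<in> carrier_mat m r"
    and sub: "vec_space.col_space m A \<subseteq> vec_space.col_space m F"
  obtains Z where "Z \<in> carrier_mat r n" "A = F * Z"
proof -
  interpret vec_space "TYPE('a)" m .
  have "set (cols A) \<subseteq> col_space A"
    unfolding col_space_def using A cols_dim[of A] by (intro in_own_span) auto
  then show thesis
    using cols_in_col_space_imp_factor[OF A F] sub that by blast
qed

section \<open>Gram matrices and rank factorization\<close>

text \<open>If the Gram matrix kills \<open>v\<close>, then the squared norm of
  \<open>P *\<^sub>v v\<close> is zero, so \<open>P\<close> kills \<open>v\<close> too; a square
  matrix with trivial kernel is invertible. The inverse yields a left inverse of \<open>P\<close>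
  and the building blocks of the pseudoinverse.\<close>

lemma gram_inverse:
  fixes P :: "'a::conjugatable_ordered_field mat"
  assumes P: "P \<in> carrier_mat m k"
    and inj: "\<And>v. v \<in> carrier_vec k \<Longrightarrow> P *\<^sub>v v = 0\<^sub>v m \<Longrightarrow> v = 0\<^sub>v k"
  obtains S where "S \<in> carrier_mat k k" "S * (mat_adjoint P * P) = 1\<^sub>m k"
    "(mat_adjoint P * P) * S = 1\<^sub>m k" "mat_adjoint S = S"
proof -
  let ?G = "mat_adjoint P * P"
  have G: "?G \<in> carrier_mat k k" using P by auto
  have "v = 0\<^sub>v k" if v: "v \<in> carrier_vec k" and 0: "?G *\<^sub>v v = 0\<^sub>v k" for v
  proof -
    define w where "w = P *\<^sub>v v"
    have w: "w \<in> carrier_vec m" unfolding w_def using P v by auto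
    have Gw: "mat_adjoint P *\<^sub>v w = 0\<^sub>v k"
      unfolding w_def using 0 assoc_mult_mat_vec[OF mat_adjoint_carrier[OF P] P v] by simp
    \<comment> \<open>Entrywise form of the adjoint relation: the pairing of
      \<open>P *\<^sub>v v\<close> with \<open>w\<close> is that of \<open>v\<close> with
      \<open>mat_adjoint P *\<^sub>v w\<close>.\<close>
    have "w \<bullet>c w = (\<Sum>i<m. (\<Sum>j<k. P $$ (i,j) * v $ j) * conjugate (w $ i))"
      using P v by (auto simp: w_def scalar_prod_def lessThan_atLeast0 intro!: sum.cong)
    also have "\<dots> = (\<Sum>j<k. v $ j * (\<Sum>i<m. P $$ (i,j) * conjugate (w $ i)))"
      unfolding sum_distrib_right sum_distrib_left
      by (subst sum.swap) (auto intro!: sum.cong simp: ac_simps)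
    also have "\<dots> = (\<Sum>j<k. v $ j * conjugate ((mat_adjoint P *\<^sub>v w) $ j))"
      using P w by (auto simp: scalar_prod_def lessThan_atLeast0 sum_conjugate conjugate_dist_mul
          intro!: sum.cong)
    also have "\<dots> = 0" unfolding Gw by simp
    finally have "w = 0\<^sub>v m" using w by simp
    then show ?thesis using inj v unfolding w_def by blast
  qed
  then have "det ?G \<noteq> 0" using det_0_iff_vec_prod_zero_field[OF G] by blast
  \<comment> \<open>The argument \<open>()\<close> only fills the dummy parameter of
    \<open>ring_mat\<close>.\<close>
  from det_non_zero_imp_unit[OF G this, of "()"]
  obtain S where S: "S \<in> carrier_mat k k" and SG: "S * ?G = 1\<^sub>m k" and GS: "?G * S = 1\<^sub>m k"
    unfolding Units_def ring_mat_def by auto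
  have "mat_adjoint S * ?G = mat_adjoint (?G * S)"
    using P S by (simp add: mat_adjoint_mult)
  also have "\<dots> = 1\<^sub>m k" using GS by simp
  finally have "mat_adjoint S * ?G = 1\<^sub>m k" .
  \<comment> \<open>The left inverse \<open>mat_adjoint S\<close> and the right inverse
    \<open>S\<close> of the same matrix coincide.\<close>
  from mult_left_cancel_one[OF this, of S] have "mat_adjoint S = S"
    using P S GS by simp
  with S SG GS show thesis by (rule that)
qed

text \<open>The columns of \<open>P\<close> are a maximal independent set of columns of
  \<open>M\<close>, hence a basis of its column space; the coordinates of the columns of
  \<open>M\<close> in this basis form \<open>Q\<close>.\<close>

lemma rank_factorization:
  fixes M :: "'a::conjugatable_ordered_field mat"
  assumes M: "M \<in> carrier_mat m n" and rank: "vec_space.rank m M = k"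
  obtains P Q L R where "P \<in> carrier_mat m k" "Q \<in> carrier_mat k n" "L \<in> carrier_mat k m"
    "R \<in> carrier_mat n k" "M = P * Q" "L * P = 1\<^sub>m k" "Q * R = 1\<^sub>m k"
proof -
  interpret vec_space "TYPE('a)" m .
  let ?Ind = "\<lambda>T. T \<subseteq> set (cols M) \<and> lin_indpt T"
  have colsM: "set (cols M) \<subseteq> carrier_vec m" using M cols_dim[of M] by auto
  have "?Ind {}" by (simp add: lin_dep_def)
  then obtain U where U: "finite U" "maximal U ?Ind"
    using maximal_exists_superset[of "set (cols M)" ?Ind "{}"] by auto
  then have ind: "lin_indpt U" and UM: "U \<subseteq> set (cols M)" by (auto simp: maximal_def)
  have cardU: "card U = k" using rank_card_indpt[OF M U(2)] rank by simp
  obtain us where us: "set us = U" "distinct us" using finite_distinct_list[OF U(1)] by blast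
  have len: "length us = k" using us cardU distinct_card by metis
  have Uc: "U \<subseteq> carrier_vec m" using UM colsM by auto
  define P where "P = mat_of_cols m us"
  have P: "P \<in> carrier_mat m k" unfolding P_def using len by auto
  have colsP: "cols P = us" unfolding P_def using us Uc by (intro cols_mat_of_cols) auto
  \<comment> \<open>A column outside the span could be adjoined to \<open>U\<close>, against
    maximality.\<close>
  have "set (cols M) \<subseteq> span U"
  proof
    fix c assume c: "c \<in> set (cols M)"
    show "c \<in> span U"
    proof (rule ccontr)
      assume n: "c \<notin> span U"
      then have cU: "c \<notin> U" using in_own_span[of U] Uc by auto
      have "lin_indpt (insert c U)"
        using lin_dep_iff_in_span[of U c] n cU ind Uc c colsM by auto
      then have "?Ind (insert c U)" using c UM by auto
      then show False using U(2) cU unfolding maximal_def by blast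
    qed
  qed
  then have "set (cols M) \<subseteq> col_space P" unfolding col_space_def colsP us .
  with cols_in_col_space_imp_factor[OF M P]
  obtain Q where Q: "Q \<in> carrier_mat k n" and MPQ: "M = P * Q" by metis
  \<comment> \<open>Conversely, the columns of \<open>P\<close> are among those of \<open>M\<close>;
    the coefficients \<open>R\<close> turn out to be a right inverse of \<open>Q\<close>.\<close>
  have "set (cols P) \<subseteq> col_space M"
    unfolding col_space_def colsP us using in_own_span[of "set (cols M)"] colsM UM by auto
  with cols_in_col_space_imp_factor[OF P M]
  obtain R where R: "R \<in> carrier_mat n k" and PMR: "P = M * R" by metis
  \<comment> \<open>As \<open>us\<close> lists an independent set without repetition, a nonzero
    kernel vector of \<open>P\<close> would be a dependence among its columns.\<close>
  have "v = 0\<^sub>v k" if "v \<in> carrier_vec k" "P *\<^sub>v v = 0\<^sub>v m" for v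
    using lin_depI[OF P that(1) _ that(2)] colsP us ind by auto
  with gram_inverse[OF P]
  obtain S where S: "S \<in> carrier_mat k k" "S * (mat_adjoint P * P) = 1\<^sub>m k" by metis
  define L where "L = S * mat_adjoint P"
  have L: "L \<in> carrier_mat k m" unfolding L_def using S P by auto
  have LP: "L * P = 1\<^sub>m k" unfolding L_def using S P by (subst mult_assoc_dim) auto
  \<comment> \<open>\<open>P * Q * R = M * R = P\<close>, and the left inverse \<open>L\<close> then
    cancels \<open>P\<close>.\<close>
  have "P * (Q * R) = P"
    using PMR MPQ P Q R by (metis assoc_mult_mat)
  then have "L * (P * (Q * R)) = 1\<^sub>m k" using LP by simp
  then have "Q * R = 1\<^sub>m k"
    using mult_left_cancel_one[OF LP, of "Q * R"] L P Q R by simp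
  with P Q L R MPQ LP show thesis by (intro that)
qed

section \<open>Uniqueness and existence of the Moore-Penrose pseudoinverse\<close>

text \<open>By self-adjointness, \<open>M * N = (M * P) * (M * N)\<close> is the adjoint of
  \<open>(M * N) * (M * P) = M * P\<close>, so \<open>M * N = M * P\<close>; likewise
  \<open>N * M = P * M\<close>. These turn \<open>N * M * N\<close> into
  \<open>P * M * P\<close>.\<close>

lemma pseudoinverse_unique:
  assumes N: "is_pseudoinverse M N" and P: "is_pseudoinverse M P"
  shows "N = P"
proof -
  have dim [simp]: "dim_row N = dim_col M" "dim_col N = dim_row M"
    "dim_row P = dim_col M" "dim_col P = dim_row M"
    using N P unfolding is_pseudoinverse_def by auto
  have n: "M * N * M = M" "N * M * N = N" "mat_adjoint (M * N) = M * N" "mat_adjoint (N * M) = N * M"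
    and p: "M * P * M = M" "P * M * P = P" "mat_adjoint (M * P) = M * P" "mat_adjoint (P * M) = P * M"
    using N P unfolding is_pseudoinverse_def by auto
  have "M * N = (M * P * M) * N" using p by simp
  also have "\<dots> = mat_adjoint (M * P) * mat_adjoint (M * N)"
    unfolding n(3) p(3) by (simp add: mult_assoc_dim)
  also have "\<dots> = mat_adjoint (M * N * (M * P))"
    by (rule mat_adjoint_mult[symmetric]) simp
  also have "M * N * (M * P) = (M * N * M) * P" by (simp add: mult_assoc_dim)
  finally have MN: "M * N = M * P" using n p by simp
  have "N * M = N * (M * P * M)" using p by simp
  also have "\<dots> = mat_adjoint (N * M) * mat_adjoint (P * M)"
    unfolding n(4) p(4) by (simp add: mult_assoc_dim)
  also have "\<dots> = mat_adjoint (P * M * (N * M))"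
    by (rule mat_adjoint_mult[symmetric]) simp
  also have "P * M * (N * M) = P * (M * N * M)" by (simp add: mult_assoc_dim)
  finally have NM: "N * M = P * M" using n p by simp
  have "N = N * M * N" using n by simp
  also have "\<dots> = P * (M * N)" unfolding NM by (simp add: mult_assoc_dim)
  also have "\<dots> = P * M * P" unfolding MN by (simp add: mult_assoc_dim)
  finally show ?thesis using p by simp
qed

text \<open>The witness is the classical formula for a full-rank factorization
  \<open>M = P * Q\<close>, with \<open>S\<close> and \<open>T\<close> the inverses of
  \<open>mat_adjoint P * P\<close> and \<open>Q * mat_adjoint Q\<close>.\<close>

lemma pseudoinverse_exists:
  fixes M :: "'a::conjugatable_ordered_field mat"
  shows "\<exists>N. is_pseudoinverse M N"
proof -
  have M: "M \<in> carrier_mat (dim_row M) (dim_col M)" by auto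
  obtain k P Q L R where P: "P \<in> carrier_mat (dim_row M) k" and Q: "Q \<in> carrier_mat k (dim_col M)"
    and L: "L \<in> carrier_mat k (dim_row M)" and R: "R \<in> carrier_mat (dim_col M) k"
    and MPQ: "M = P * Q" and LP: "L * P = 1\<^sub>m k" and QR: "Q * R = 1\<^sub>m k"
    using rank_factorization[OF M refl] by metis
  have left_inj: "v = 0\<^sub>v k"
    if "A \<in> carrier_mat k d" "B \<in> carrier_mat d k" "A * B = 1\<^sub>m k"
      "v \<in> carrier_vec k" "B *\<^sub>v v = 0\<^sub>v d" for A B :: "'a mat" and v d
  proof -
    have "v = (A * B) *\<^sub>v v" using that by simp
    also have "\<dots> = A *\<^sub>v (B *\<^sub>v v)" using that by (intro assoc_mult_mat_vec)
    also have "\<dots> = 0\<^sub>v k" using that by auto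
    finally show ?thesis .
  qed
  obtain S where S: "S \<in> carrier_mat k k" "S * (mat_adjoint P * P) = 1\<^sub>m k" "mat_adjoint S = S"
    using gram_inverse[OF P left_inj[OF L P LP]] by metis
  \<comment> \<open>\<open>Q * mat_adjoint Q\<close> is the Gram matrix of
    \<open>mat_adjoint Q\<close>, which is injective because \<open>mat_adjoint R\<close> is a left
    inverse of it.\<close>
  have Q': "mat_adjoint Q \<in> carrier_mat (dim_col M) k" using Q by simp
  have R': "mat_adjoint R \<in> carrier_mat k (dim_col M)" using R by simp
  have RQ: "mat_adjoint R * mat_adjoint Q = 1\<^sub>m k"
    using QR Q R by (simp flip: mat_adjoint_mult)
  obtain T where T: "T \<in> carrier_mat k k" "(Q * mat_adjoint Q) * T = 1\<^sub>m k"
      "mat_adjoint T = T"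
    using gram_inverse[OF Q' left_inj[OF R' Q' RQ]] by (metis mat_adjoint_adjoint)
  define N where "N = mat_adjoint Q * T * S * mat_adjoint P"
  note dims = carrier_matD[OF P] carrier_matD[OF Q] carrier_matD[OF S(1)] carrier_matD[OF T(1)]
  \<comment> \<open>The trailing factor \<open>X\<close> makes these cancellations usable as rewrite
    rules inside products associated to the right.\<close>
  have T': "Q * (mat_adjoint Q * (T * X)) = X" if "dim_row X = k" for X
    using mult_left_cancel_one[OF T(2), of X] that dims by (simp add: mult_assoc_dim)
  have S': "S * (mat_adjoint P * (P * X)) = X" if "dim_row X = k" for X
    using mult_left_cancel_one[OF S(2), of X] that dims by (simp add: mult_assoc_dim)
  have MN: "M * N = P * S * mat_adjoint P"
    unfolding N_def by (subst MPQ) (simp add: mult_assoc_dim dims T')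
  have NM: "N * M = mat_adjoint Q * T * Q"
    unfolding N_def by (subst MPQ) (simp add: mult_assoc_dim dims S')
  have "is_pseudoinverse M N"
    unfolding is_pseudoinverse_def
  proof (intro conjI)
    show "N \<in> carrier_mat (dim_col M) (dim_row M)"
      unfolding N_def using dims by (intro carrier_matI) auto
    have "M * N * M = P * Q" unfolding MN by (subst MPQ) (simp add: mult_assoc_dim dims S')
    then show "M * N * M = M" using MPQ by simp
    show "N * M * N = N" unfolding NM by (simp add: N_def mult_assoc_dim dims T')
    \<comment> \<open>Reduces to the self-adjointness of \<open>S\<close>, and the next equation to
      that of \<open>T\<close>.\<close>
    show "mat_adjoint (M * N) = M * N"
      unfolding MN by (simp add: mat_adjoint_mult mult_assoc_dim dims S)
    show "mat_adjoint (N * M) = N * M"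
      unfolding NM by (simp add: mat_adjoint_mult mult_assoc_dim dims T)
  qed
  then show ?thesis by blast
qed

lemma is_pseudoinverse_pseudoinverse:
  fixes M :: "'a::conjugatable_ordered_field mat"
  shows "is_pseudoinverse M (pseudoinverse M)"
  unfolding pseudoinverse_def
  using pseudoinverse_exists[of M] pseudoinverse_unique by (metis theI)

section \<open>Recovering a matrix from a product of the same rank\<close>

text \<open>
  If $M = PQ$ has inner dimension \<open>k\<close> and $NM$ has rank \<open>k\<close>, then a rank factorization
  $NM = P'Q'$ with one-sided inverses $L'$, $R'$ gives $(L'NP)(QR') = 1$. Both factors are square,
  so also $(QR')(L'NP) = 1$, which can be inserted between \<open>P\<close> and \<open>Q\<close>.
\<close>
lemma recover_from_left_mult:
  fixes P :: "'a::conjugatable_ordered_field mat"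
  assumes P: "P \<in> carrier_mat m k" and Q: "Q \<in> carrier_mat k n" and N: "N \<in> carrier_mat s m"
    and rank: "vec_space.rank s (N * (P * Q)) = k"
  obtains U where "U \<in> carrier_mat m s" "P * Q = U * (N * (P * Q))"
proof -
  have "N * (P * Q) \<in> carrier_mat s n" using P Q N by auto
  from rank_factorization[OF this rank]
  obtain P' Q' L R where P': "P' \<in> carrier_mat s k" "Q' \<in> carrier_mat k n"
    and L: "L \<in> carrier_mat k s" and R: "R \<in> carrier_mat n k"
    and f: "N * (P * Q) = P' * Q'" "L * P' = 1\<^sub>m k" "Q' * R = 1\<^sub>m k" by metis
  note dims = carrier_matD[OF P] carrier_matD[OF Q] carrier_matD[OF N] carrier_matD[OF L]
    carrier_matD[OF R] carrier_matD[OF P'(1)] carrier_matD[OF P'(2)]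
  have "(L * N * P) * (Q * R) = L * (N * (P * Q)) * R"
    by (simp add: mult_assoc_dim dims)
  also have "\<dots> = 1\<^sub>m k"
    unfolding f(1) using f(3) mult_left_cancel_one[OF f(2), of Q'] by (simp add: dims)
  finally have "(Q * R) * (L * N * P) = 1\<^sub>m k"
    by (rule mat_mult_left_right_inverse[rotated 2]) (use P Q N L R in auto)
  then have "Q * R * (L * N * P * Q) = Q"
    by (rule mult_left_cancel_one) (simp_all add: dims)
  then have "P * Q = P * (Q * R * (L * N * P * Q))" by (rule arg_cong[symmetric])
  also have "\<dots> = (P * Q * R * L) * (N * (P * Q))"
    by (simp add: mult_assoc_dim dims)
  finally have "P * Q = (P * Q * R * L) * (N * (P * Q))" .
  moreover have "P * Q * R * L \<in> carrier_mat m s" using P Q R L by auto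
  ultimately show thesis by (intro that)
qed

text \<open>Mirror image of \<open>recover_from_left_mult\<close>: now
  \<open>(L * P) * (Q * N * R)\<close> is the identity, and its square factors commute. Passing to
  adjoints instead would require that a matrix and its adjoint have equal rank.\<close>

lemma recover_from_right_mult:
  fixes P :: "'a::conjugatable_ordered_field mat"
  assumes P: "P \<in> carrier_mat m k" and Q: "Q \<in> carrier_mat k n" and N: "N \<in> carrier_mat n s"
    and rank: "vec_space.rank m (P * Q * N) = k"
  obtains V where "V \<in> carrier_mat s n" "P * Q = (P * Q * N) * V"
proof -
  have "P * Q * N \<in> carrier_mat m s" using P Q N by auto
  from rank_factorization[OF this rank]
  obtain P' Q' L R where P': "P' \<in> carrier_mat m k" "Q' \<in> carrier_mat k s"
    and L: "L \<in> carrier_mat k m" and R: "R \<in> carrier_mat s k"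
    and f: "P * Q * N = P' * Q'" "L * P' = 1\<^sub>m k" "Q' * R = 1\<^sub>m k" by metis
  note dims = carrier_matD[OF P] carrier_matD[OF Q] carrier_matD[OF N] carrier_matD[OF L]
    carrier_matD[OF R] carrier_matD[OF P'(1)] carrier_matD[OF P'(2)]
  have "(L * P) * (Q * N * R) = L * (P * Q * N) * R"
    by (simp add: mult_assoc_dim dims)
  also have "\<dots> = 1\<^sub>m k"
    unfolding f(1) using f(3) mult_left_cancel_one[OF f(2), of Q'] by (simp add: dims)
  finally have "(Q * N * R) * (L * P) = 1\<^sub>m k"
    by (rule mat_mult_left_right_inverse[rotated 2]) (use P Q N L R in auto)
  then have "Q * N * R * (L * P * Q) = Q"
    by (rule mult_left_cancel_one) (simp_all add: dims)
  then have "P * Q = P * (Q * N * R * (L * P * Q))" by (rule arg_cong[symmetric])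
  also have "\<dots> = (P * Q * N) * (R * L * P * Q)"
    by (simp add: mult_assoc_dim dims)
  finally have "P * Q = (P * Q * N) * (R * L * P * Q)" .
  moreover have "R * L * P * Q \<in> carrier_mat s n" using P Q R L by auto
  ultimately show thesis by (intro that)
qed

section \<open>The factorization over a general ordered field with conjugation, and its two
  instances\<close>

text \<open>The type class covers the real and the complex numbers at once. The variable
  \<open>Y\<close> stands for the matrix called \<open>Ystar\<close> in the theorem.\<close>

lemma factorization_through_F_and_adjoint_H:
  fixes A F H B D W :: "'a::conjugatable_ordered_field mat"
  assumes A: "A \<in> carrier_mat m n" and F: "F \<in> carrier_mat m r" and H: "H \<in> carrier_mat n q"
    and rank_F: "vec_space.rank m F = k" and rank_H: "vec_space.rank n H = k"
    and AF: "vec_space.col_space m A \<subseteq> vec_space.col_space m F"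
    and AH: "vec_space.col_space n (mat_adjoint A) \<subseteq> vec_space.col_space n H"
    and B: "B \<in> carrier_mat m r" and D: "D \<in> carrier_mat n q"
    and rank_BF: "vec_space.rank r (mat_adjoint B * F) = k"
    and rank_HD: "vec_space.rank q (mat_adjoint H * D) = k"
    and W: "W \<in> carrier_mat r q"
    and Y: "Y = pseudoinverse (mat_adjoint B * F) * mat_adjoint B"
    and X: "X = D * pseudoinverse (mat_adjoint H * D)"
  shows "A = F * (Y * A * X + W - Y * F * W * mat_adjoint H * X) * mat_adjoint H"
proof -
  let ?B = "mat_adjoint B" and ?H = "mat_adjoint H"
  define M1 M2 where "M1 = ?B * F" and "M2 = ?H * D"
  define N1 N2 where "N1 = pseudoinverse M1" and "N2 = pseudoinverse M2"
  have M1: "M1 \<in> carrier_mat r r" and M2: "M2 \<in> carrier_mat q q"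
    unfolding M1_def M2_def using B F H D by auto
  have N1: "N1 \<in> carrier_mat r r" "M1 * N1 * M1 = M1"
    and N2: "N2 \<in> carrier_mat q q" "M2 * N2 * M2 = M2"
    using is_pseudoinverse_pseudoinverse[of M1] is_pseudoinverse_pseudoinverse[of M2] M1 M2
    unfolding N1_def N2_def is_pseudoinverse_def by auto
  have Y': "Y = N1 * ?B" and X': "X = D * N2"
    unfolding X Y N1_def N2_def M1_def M2_def by simp_all
  have Yc: "Y \<in> carrier_mat r m" and Xc: "X \<in> carrier_mat n q"
    unfolding Y' X' using N1 N2 B D by auto

  \<comment> \<open>The equality of the ranks of \<open>F\<close> and \<open>M1\<close> enters as a
    factorization of \<open>F\<close> whose inner dimension is the rank of
    \<open>M1\<close>.\<close>
  obtain P Q where PQ: "P \<in> carrier_mat m k" "Q \<in> carrier_mat k r" and FPQ: "F = P * Q"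
    using rank_factorization[OF F rank_F] by metis
  obtain U where U: "U \<in> carrier_mat m r" and FU: "F = U * M1"
    using recover_from_left_mult[OF PQ mat_adjoint_carrier[OF B]] rank_BF
    unfolding M1_def FPQ by metis
  obtain P' Q' where PQ': "P' \<in> carrier_mat n k" "Q' \<in> carrier_mat k q" and HPQ: "H = P' * Q'"
    using rank_factorization[OF H rank_H] by metis
  \<comment> \<open>Taking adjoints of the factors keeps the inner dimension \<open>k\<close>, so
    the rank of \<open>?H\<close> itself need not be computed.\<close>
  have H': "?H = mat_adjoint Q' * mat_adjoint P'"
    unfolding HPQ using PQ' by (intro mat_adjoint_mult) auto
  obtain V where V: "V \<in> carrier_mat q n" and HV: "?H = M2 * V"
    using recover_from_right_mult[OF mat_adjoint_carrier[OF PQ'(2)] mat_adjoint_carrier[OF PQ'(1)] D]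
      rank_HD unfolding M2_def H' by metis

  note dims = carrier_matD[OF A] carrier_matD[OF F] carrier_matD[OF H] carrier_matD[OF B]
    carrier_matD[OF D] carrier_matD[OF W] carrier_matD[OF U] carrier_matD[OF V]
    carrier_matD[OF N1(1)] carrier_matD[OF N2(1)] carrier_matD[OF M1] carrier_matD[OF M2]
    carrier_matD[OF Yc] carrier_matD[OF Xc]

  \<comment> \<open>Only the first \<open>F\<close> is replaced; the second one joins
    \<open>?B\<close> to form another \<open>M1\<close>. Below, only the second \<open>?H\<close> is
    replaced, and the first joins \<open>D\<close> to form \<open>M2\<close>.\<close>
  have "F * Y * F = U * M1 * N1 * (?B * F)"
    unfolding Y' by (subst (1) FU) (simp add: mult_assoc_dim dims)
  also have "\<dots> = U * (M1 * N1 * M1)"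
    unfolding M1_def[symmetric] by (simp add: mult_assoc_dim dims)
  finally have FYF: "F * Y * F = F" using N1 FU by simp
  have "?H * X * ?H = ?H * D * N2 * (M2 * V)"
    unfolding X' by (subst (2) HV) (simp add: mult_assoc_dim dims)
  also have "\<dots> = (M2 * N2 * M2) * V"
    unfolding M2_def[symmetric] by (simp add: mult_assoc_dim dims)
  finally have HXH: "?H * X * ?H = ?H" using N2 HV by simp

  obtain Z where Z: "Z \<in> carrier_mat r n" and AZ: "A = F * Z"
    using col_space_subset_imp_factor[OF A F AF] by metis
  obtain Z' where Z': "Z' \<in> carrier_mat q m" and AZ': "mat_adjoint A = H * Z'"
    using col_space_subset_imp_factor[OF mat_adjoint_carrier[OF A] H AH] by metis
  \<comment> \<open>The adjoint of \<open>H * Z'\<close> exhibits \<open>?H\<close> as a right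
    factor of \<open>A\<close>.\<close>
  have "A = mat_adjoint (H * Z')" using AZ' by (metis mat_adjoint_adjoint)
  then have AZ'': "A = mat_adjoint Z' * ?H" using H Z' by (simp add: mat_adjoint_mult)
  have "F * Y * A = F * Y * F * Z" unfolding AZ using F Yc Z by (simp add: mult_assoc_dim)
  then have FYA: "F * Y * A = A" unfolding FYF AZ .
  have "A * X * ?H = mat_adjoint Z' * (?H * X * ?H)"
    unfolding AZ'' using H Xc Z' by (simp add: mult_assoc_dim)
  then have AXH: "A * X * ?H = A" unfolding HXH AZ''[symmetric] .

  let ?K = "Y * A * X" and ?E = "Y * F * W * ?H * X"
  have K: "?K \<in> carrier_mat r q" and E: "?E \<in> carrier_mat r q"
    using A F H W Xc Yc by auto
  have "F * (?K + W - ?E) * ?H = (F * ?K + F * W - F * ?E) * ?H"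
    using mult_minus_distrib_mat[OF F add_carrier_mat[OF W, of ?K] E]
      mult_add_distrib_mat[OF F K W] by simp
  also have "\<dots> = F * ?K * ?H + F * W * ?H - F * ?E * ?H"
    using minus_mult_distrib_mat[of "F * ?K + F * W" m q "F * ?E" ?H n]
      add_mult_distrib_mat[of "F * ?K" m q "F * W" ?H n] F K W E H by simp
  also have "F * ?K * ?H = (F * Y * A) * X * ?H"
    by (simp add: mult_assoc_dim dims)
  also have "\<dots> = A" unfolding FYA AXH ..
  also have "F * ?E * ?H = (F * Y * F) * W * (?H * X * ?H)"
    by (simp add: mult_assoc_dim dims)
  also have "\<dots> = F * W * ?H" unfolding FYF HXH ..
  also have "A + F * W * ?H - F * W * ?H = A"
    using A F W H by (intro eq_matI) auto
  finally show ?thesis by simp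
qed

theorem theorem3:
  fixes m n r q k :: nat
  assumes "k \<le> min m n" and "k \<le> r" and "k \<le> q"
  shows
   "(\<forall>A F H B D :: real mat.
       A \<in> carrier_mat m n \<longrightarrow> F \<in> carrier_mat m r \<longrightarrow> H \<in> carrier_mat n q \<longrightarrow>
       vec_space.rank m A = k \<longrightarrow> vec_space.rank m F = k \<longrightarrow> vec_space.rank n H = k \<longrightarrow>
       vec_space.col_space m A \<subseteq> vec_space.col_space m F \<longrightarrow>
       vec_space.col_space n (mat_adjoint A) \<subseteq> vec_space.col_space n H \<longrightarrow>
       B \<in> carrier_mat m r \<longrightarrow> D \<in> carrier_mat n q \<longrightarrow>
       vec_space.rank r (mat_adjoint B * F) = k \<longrightarrow>
       vec_space.rank q (mat_adjoint H * D) = k \<longrightarrow>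
       (let Ystar = pseudoinverse (mat_adjoint B * F) * mat_adjoint B;
            X = D * pseudoinverse (mat_adjoint H * D)
        in \<forall>W \<in> carrier_mat r q.
             let G = Ystar * A * X + W - Ystar * F * W * mat_adjoint H * X
             in A = F * G * mat_adjoint H))
    \<and>
    (\<forall>A F H B D :: complex mat.
       A \<in> carrier_mat m n \<longrightarrow> F \<in> carrier_mat m r \<longrightarrow> H \<in> carrier_mat n q \<longrightarrow>
       vec_space.rank m A = k \<longrightarrow> vec_space.rank m F = k \<longrightarrow> vec_space.rank n H = k \<longrightarrow>
       vec_space.col_space m A \<subseteq> vec_space.col_space m F \<longrightarrow>
       vec_space.col_space n (mat_adjoint A) \<subseteq> vec_space.col_space n H \<longrightarrow>
       B \<in> carrier_mat m r \<longrightarrow> D \<in> carrier_mat n q \<longrightarrow>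
       vec_space.rank r (mat_adjoint B * F) = k \<longrightarrow>
       vec_space.rank q (mat_adjoint H * D) = k \<longrightarrow>
       (let Ystar = pseudoinverse (mat_adjoint B * F) * mat_adjoint B;
            X = D * pseudoinverse (mat_adjoint H * D)
        in \<forall>W \<in> carrier_mat r q.
             let G = Ystar * A * X + W - Ystar * F * W * mat_adjoint H * X
             in A = F * G * mat_adjoint H))"
  \<comment> \<open>The two \<open>refl\<close> solve the equations that define \<open>Y\<close> and
    \<open>X\<close>.\<close>
  unfolding Let_def by (blast intro: factorization_through_F_and_adjoint_H[OF _ _ _ _ _ _ _ _ _ _ _ _ refl refl])

end
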